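(* Let $k \geq 3$ be an integer. Then there are infinitely many (pairwise non-isomorphic) $k$-regular graphs whose smallest eigenvalue lies in the half-open interval $[-1-\sqrt{2}, -2)$. Moreover, there are infinitely many (pairwise non-isomorphic) $3$-regular triangle-free graphs whose smallest eigenvalue lies in $[-1-\sqrt{2}, -2)$.
   Context: All graphs are finite, undirected, without loops and without multiple edges. The eigenvalues of a graph are the eigenvalues of its adjacency matrix (the $(0,1)$-matrix indexed by the vertices whose $(x,y)$-entry is $1$ iff $x$ and $y$ are adjacent). A graph is $k$-regular if every vertex has exactly $k$ neighbours. *)

theory Defs
  imports
    Complex_Main
    "Graph_Theory.Pair_Digraph"
    "Graph_Theory.Digraph_Isomorphism"
    "Jordan_Normal_Form.Spectral_Radius"
begin

text \<open>
  An undirected edge between x and y is the pair of arcs (x, y) and (y, x), and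
  \<open>pair_graph\<close> says that the graph is finite, symmetric and without loops. Multiple
  edges cannot occur because arcs are pairs of vertices.
\<close>

definition adjacent :: "'a pair_pre_digraph \<Rightarrow> 'a \<Rightarrow> 'a \<Rightarrow> bool" where
  "adjacent G x y \<longleftrightarrow> (x, y) \<in> parcs G"

definition k_regular :: "nat \<Rightarrow> 'a pair_pre_digraph \<Rightarrow> bool" where
  "k_regular k G \<longleftrightarrow> (\<forall>x\<in>pverts G. card {y \<in> pverts G. adjacent G x y} = k)"

definition triangle_free :: "'a pair_pre_digraph \<Rightarrow> bool" where
  "triangle_free G \<longleftrightarrow>
    \<not> (\<exists>x\<in>pverts G. \<exists>y\<in>pverts G. \<exists>z\<in>pverts G.
         adjacent G x y \<and> adjacent G y z \<and> adjacent G x z)"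

text \<open>
  Matrices are indexed by initial segments of the naturals, so the vertices are
  numbered in increasing order; the eigenvalues do not depend on the numbering.
\<close>

definition adjacency_matrix :: "'a::linorder pair_pre_digraph \<Rightarrow> real mat" where
  "adjacency_matrix G =
    (let vs = sorted_list_of_set (pverts G); n = length vs
     in mat n n (\<lambda>(i, j). if adjacent G (vs ! i) (vs ! j) then 1 else 0))"

text \<open>
  The adjacency matrix is real symmetric, so all its eigenvalues are real. The minimum
  is that of a finite nonempty set as soon as the graph has a vertex.
\<close>

definition smallest_eigenvalue :: "'a::linorder pair_pre_digraph \<Rightarrow> real" where
  "smallest_eigenvalue G = Min (spectrum (adjacency_matrix G))"

text \<open>
  Every finite graph is isomorphic to one with natural numbers as vertices, so vertices
  of type \<open>nat\<close> lose no isomorphism class.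
\<close>

definition infinitely_many_graphs :: "(nat pair_pre_digraph \<Rightarrow> bool) \<Rightarrow> bool" where
  "infinitely_many_graphs P \<longleftrightarrow>
    (\<exists>\<G>. infinite \<G> \<and>
         (\<forall>G\<in>\<G>. pair_graph G \<and> pverts G \<noteq> {} \<and> P G) \<and>
         pairwise (\<lambda>G H. \<not> digraph_iso (with_proj G) (with_proj H)) \<G>)"

end

theory Submission
  imports Defs "HOL-Library.Countable"
begin

text \<open>
  Graphs need not be connected, so the disjoint unions of \<open>n\<close> copies of one graph, \<open>n \<ge> 1\<close>,
  form an infinite family with constant degree and smallest eigenvalue. It remains to find one
  graph with smallest eigenvalue exactly \<open>- 1 - sqrt 2\<close> in each case. In the triangle-free
  case it is the Wagner graph, the 8-cycle with its antipodal chords. For general \<open>k\<close> the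
  edges are partitioned into disjoint cliques, each with smallest eigenvalue \<open>- 1\<close>, and
  disjoint paths on three vertices, each with smallest eigenvalue \<open>- sqrt 2\<close>; the two
  bounds add up, and they are attained by a common vector.
\<close>

section \<open>Eigenvalues as functions on the vertices\<close>

lemma adjacency_matrix_mult_vec:
  fixes G :: "'a::linorder pair_pre_digraph"
  assumes "finite (pverts G)"
  defines "vs \<equiv> sorted_list_of_set (pverts G)"
  shows "adjacency_matrix G *\<^sub>v vec (length vs) (\<lambda>i. f (vs ! i))
       = vec (length vs) (\<lambda>i. \<Sum>y\<in>{y \<in> pverts G. adjacent G (vs ! i) y}. f y)"
proof (rule eq_vecI)
  let ?V = "pverts G" and ?n = "length vs"
  have A: "adjacency_matrix G =
      mat ?n ?n (\<lambda>(i, j). if adjacent G (vs ! i) (vs ! j) then 1 else 0)"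
    by (simp add: adjacency_matrix_def vs_def Let_def)
  have bij: "bij_betw ((!) vs) {..<?n} ?V"
    using assms(1) by (intro bij_betw_nth) (auto simp: vs_def)
  show "(adjacency_matrix G *\<^sub>v vec ?n (\<lambda>i. f (vs ! i))) $ i
      = vec ?n (\<lambda>i. \<Sum>y\<in>{y \<in> ?V. adjacent G (vs ! i) y}. f y) $ i"
    if "i < dim_vec (vec ?n (\<lambda>i. \<Sum>y\<in>{y \<in> ?V. adjacent G (vs ! i) y}. f y))" for i
  proof -
    from that have i: "i < ?n" by simp
    have "(adjacency_matrix G *\<^sub>v vec ?n (\<lambda>i. f (vs ! i))) $ i
        = (\<Sum>j<?n. if adjacent G (vs ! i) (vs ! j) then f (vs ! j) else 0)"
      using i by (auto simp: A scalar_prod_def lessThan_atLeast0 intro!: sum.cong)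
    also have "\<dots> = (\<Sum>y\<in>?V. if adjacent G (vs ! i) y then f y else 0)"
      by (rule sum.reindex_bij_betw[OF bij])
    also have "\<dots> = (\<Sum>y\<in>{y \<in> ?V. adjacent G (vs ! i) y}. f y)"
      by (rule sum.inter_filter[symmetric]) fact
    finally show ?thesis using i by simp
  qed
qed (simp add: adjacency_matrix_def vs_def Let_def)

text \<open>The sorted list enumerates the vertices bijectively, so every vector comes from a
  function on \<open>pverts G\<close> and the eigenvector equation carries over entry by entry. From
  here on the numbering disappears.\<close>

lemma spectrum_adjacency_matrix_iff:
  fixes G :: "'a::linorder pair_pre_digraph"
  assumes fin: "finite (pverts G)"
  shows "\<mu> \<in> spectrum (adjacency_matrix G) \<longleftrightarrow>
    (\<exists>f. (\<exists>x\<in>pverts G. f x \<noteq> 0) \<and>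
      (\<forall>x\<in>pverts G. (\<Sum>y\<in>{y \<in> pverts G. adjacent G x y}. f y) = \<mu> * f x))"
    (is "?L \<longleftrightarrow> (\<exists>f. ?R f)")
proof -
  define vs where "vs = sorted_list_of_set (pverts G)"
  let ?V = "pverts G" and ?n = "length vs" and ?A = "adjacency_matrix G"
  let ?v = "\<lambda>f :: 'a \<Rightarrow> real. vec ?n (\<lambda>i. f (vs ! i))"
  have set: "set vs = ?V" using fin by (simp add: vs_def)
  have bij: "bij_betw ((!) vs) {..<?n} ?V"
    using fin by (intro bij_betw_nth) (auto simp: vs_def)
  have dim: "dim_row ?A = ?n"
    by (simp add: adjacency_matrix_def vs_def Let_def)
  have eig: "eigenvector ?A (?v f) \<mu> \<longleftrightarrow> ?R f" for f
  proof -
    have all: "(\<forall>x\<in>?V. P x) \<longleftrightarrow> (\<forall>i<?n. P (vs ! i))" for P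
      by (simp add: set[symmetric] all_set_conv_all_nth)
    have "?v f = 0\<^sub>v ?n \<longleftrightarrow> (\<forall>x\<in>?V. f x = 0)"
      unfolding all by (auto simp: vec_eq_iff)
    moreover have "?A *\<^sub>v ?v f = \<mu> \<cdot>\<^sub>v ?v f \<longleftrightarrow>
        (\<forall>x\<in>?V. (\<Sum>y\<in>{y \<in> ?V. adjacent G x y}. f y) = \<mu> * f x)"
      unfolding all by (auto simp: adjacency_matrix_mult_vec[OF fin, folded vs_def] vec_eq_iff)
    ultimately show ?thesis by (simp add: eigenvector_def dim)
  qed
  have surj: "\<exists>f. v = ?v f" if "v \<in> carrier_vec ?n" for v
  proof
    show "v = ?v (\<lambda>x. v $ the_inv_into {..<?n} ((!) vs) x)"
      using that bij by (auto simp: vec_eq_iff the_inv_into_f_f bij_betw_def)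
  qed
  show ?thesis
  proof
    assume ?L
    then obtain v where v: "eigenvector ?A v \<mu>"
      by (auto simp: spectrum_def eigenvalue_def)
    then obtain f where "v = ?v f"
      using surj by (auto simp: eigenvector_def dim)
    with v eig show "\<exists>f. ?R f" by auto
  next
    assume "\<exists>f. ?R f"
    with eig show ?L by (auto simp: spectrum_def eigenvalue_def)
  qed
qed

text \<open>This is the Rayleigh criterion: \<open>bound\<close>, tested on an eigenfunction
  \<open>g\<close> for an eigenvalue \<open>\<mu>\<close>, compares \<open>\<theta>\<close> and
  \<open>\<mu>\<close> times the squared norm of \<open>g\<close>, which is positive. The function
  \<open>f\<close> shows that \<open>\<theta>\<close> is attained.\<close>

lemma smallest_eigenvalue_eqI:
  fixes G :: "'a::linorder pair_pre_digraph"
  assumes fin: "finite (pverts G)"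
    and nz: "x \<in> pverts G" "f x \<noteq> 0"
    and eig: "\<And>x. x \<in> pverts G \<Longrightarrow>
      (\<Sum>y\<in>{y \<in> pverts G. adjacent G x y}. f y) = \<theta> * f x"
    and bound: "\<And>g. \<theta> * (\<Sum>x\<in>pverts G. (g x)\<^sup>2)
      \<le> (\<Sum>x\<in>pverts G. g x * (\<Sum>y\<in>{y \<in> pverts G. adjacent G x y}. g y))"
  shows "smallest_eigenvalue G = \<theta>"
  unfolding smallest_eigenvalue_def
proof (rule Min_eqI)
  have "adjacency_matrix G \<in> carrier_mat (card (pverts G)) (card (pverts G))"
    by (simp add: adjacency_matrix_def Let_def)
  then show "finite (spectrum (adjacency_matrix G))"
    by (rule card_finite_spectrum)
  show "\<theta> \<in> spectrum (adjacency_matrix G)"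
    using nz eig by (auto simp: spectrum_adjacency_matrix_iff[OF fin])
  show "\<theta> \<le> \<mu>" if "\<mu> \<in> spectrum (adjacency_matrix G)" for \<mu>
  proof -
    from that obtain g x where g: "x \<in> pverts G" "g x \<noteq> 0"
      and eig: "\<And>x. x \<in> pverts G \<Longrightarrow>
        (\<Sum>y\<in>{y \<in> pverts G. adjacent G x y}. g y) = \<mu> * g x"
      by (auto simp: spectrum_adjacency_matrix_iff[OF fin])
    have "\<theta> * (\<Sum>x\<in>pverts G. (g x)\<^sup>2) \<le> (\<Sum>x\<in>pverts G. g x * (\<mu> * g x))"
      using bound[of g] eig by (simp cong: sum.cong)
    also have "\<dots> = \<mu> * (\<Sum>x\<in>pverts G. (g x)\<^sup>2)"
      by (simp add: sum_distrib_left power2_eq_square mult_ac)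
    finally show ?thesis
      using g fin by (subst (asm) mult_le_cancel_right_pos) (auto intro!: sum_pos2)
  qed
qed

section \<open>Disjoint copies of a finite graph\<close>

text \<open>Pairs of copy index and vertex are coded by the injective \<open>to_nat\<close>, because
  \<open>infinitely_many_graphs\<close> asks for vertices in \<open>nat\<close>.\<close>

definition copies :: "nat \<Rightarrow> 'a::countable set \<Rightarrow> ('a \<Rightarrow> 'a \<Rightarrow> bool) \<Rightarrow> nat pair_pre_digraph" where
  "copies n V E = \<lparr> pverts = to_nat ` ({..<n} \<times> V),
     parcs = {(to_nat (c, u), to_nat (c, v)) | c u v. c < n \<and> u \<in> V \<and> v \<in> V \<and> E u v} \<rparr>"

lemma pverts_copies [simp]: "pverts (copies n V E) = to_nat ` ({..<n} \<times> V)"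
  by (simp add: copies_def)

lemma adjacent_copies_iff [simp]:
  "adjacent (copies n V E) (to_nat (c, u)) (to_nat (d, v)) \<longleftrightarrow>
     c = d \<and> c < n \<and> u \<in> V \<and> v \<in> V \<and> E u v"
  by (auto simp: adjacent_def copies_def)

lemma neighbours_copies:
  assumes "c < n" "u \<in> V"
  shows "{y \<in> pverts (copies n V E). adjacent (copies n V E) (to_nat (c, u)) y}
       = (\<lambda>v. to_nat (c, v)) ` {v \<in> V. E u v}"
  using assms by auto

lemma sum_neighbours_copies:
  assumes "c < n" "u \<in> V"
  shows "(\<Sum>y\<in>{y \<in> pverts (copies n V E). adjacent (copies n V E) (to_nat (c, u)) y}. f y)
       = (\<Sum>v\<in>{v \<in> V. E u v}. f (to_nat (c, v)))"
  unfolding neighbours_copies[OF assms] by (subst sum.reindex) (auto simp: inj_on_def)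

lemma k_regular_copies:
  assumes "\<And>u. u \<in> V \<Longrightarrow> card {v \<in> V. E u v} = k"
  shows "k_regular k (copies n V E)"
proof -
  \<comment> \<open>Summing the constant 1 counts neighbours, so
    \<open>sum_neighbours_copies\<close> yields degrees as well.\<close>
  have "card {y \<in> pverts (copies n V E). adjacent (copies n V E) (to_nat (c, u)) y} = k"
    if "c < n" "u \<in> V" for c u
    using assms[OF that(2)] sum_neighbours_copies[OF that, where E = E and f = "\<lambda>_. 1 :: nat"] by simp
  then show ?thesis
    unfolding k_regular_def by (auto simp del: adjacent_copies_iff)
qed

lemma triangle_free_copies:
  assumes "\<And>u v w. u \<in> V \<Longrightarrow> v \<in> V \<Longrightarrow> w \<in> V \<Longrightarrow> E u v \<Longrightarrow> E v w \<Longrightarrow> \<not> E u w"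
  shows "triangle_free (copies n V E)"
proof -
  have "\<not> (adjacent (copies n V E) (to_nat p) (to_nat q)
      \<and> adjacent (copies n V E) (to_nat q) (to_nat r)
      \<and> adjacent (copies n V E) (to_nat p) (to_nat r))" for p q r :: "nat \<times> 'a"
    by (cases p; cases q; cases r; hypsubst; unfold adjacent_copies_iff) (use assms in metis)
  then show ?thesis
    unfolding triangle_free_def pverts_copies by blast
qed

text \<open>No edge joins two copies, so the quadratic form is the sum of the forms of the copies
  and the bounds add up. An eigenfunction of one copy, repeated on all of them, stays an
  eigenfunction.\<close>

lemma smallest_eigenvalue_copies:
  assumes fin: "finite V" and n: "n > 0"
    and nz: "u \<in> V" "f u \<noteq> 0"
    and eig: "\<And>u. u \<in> V \<Longrightarrow> (\<Sum>v\<in>{v \<in> V. E u v}. f v) = \<theta> * f u"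
    and bound: "\<And>g. \<theta> * (\<Sum>u\<in>V. (g u)\<^sup>2) \<le> (\<Sum>u\<in>V. g u * (\<Sum>v\<in>{v \<in> V. E u v}. g v))"
  shows "smallest_eigenvalue (copies n V E) = \<theta>"
proof (rule smallest_eigenvalue_eqI)
  let ?G = "copies n V E"
  let ?f = "\<lambda>x. f (snd (from_nat x :: nat \<times> 'a))"
  have sum_pverts: "(\<Sum>x\<in>pverts ?G. h x) = (\<Sum>c<n. \<Sum>u\<in>V. h (to_nat (c, u)))" for h :: "nat \<Rightarrow> real"
    by (simp add: sum.reindex sum.cartesian_product case_prod_unfold)
  show "finite (pverts ?G)" using fin by simp
  show "to_nat (0 :: nat, u) \<in> pverts ?G" "?f (to_nat (0 :: nat, u)) \<noteq> 0"
    using n nz by auto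
  show "(\<Sum>y\<in>{y \<in> pverts ?G. adjacent ?G x y}. ?f y) = \<theta> * ?f x" if x: "x \<in> pverts ?G" for x
  proof -
    from x obtain c v where "x = to_nat (c, v)" "c < n" "v \<in> V" by auto
    then show ?thesis
      by (simp only: sum_neighbours_copies) (simp add: eig)
  qed
  fix g :: "nat \<Rightarrow> real"
  have "\<theta> * (\<Sum>x\<in>pverts ?G. (g x)\<^sup>2) = (\<Sum>c<n. \<theta> * (\<Sum>u\<in>V. (g (to_nat (c, u)))\<^sup>2))"
    by (simp only: sum_pverts sum_distrib_left)
  also have "\<dots> \<le> (\<Sum>c<n. \<Sum>u\<in>V. g (to_nat (c, u)) * (\<Sum>v\<in>{v \<in> V. E u v}. g (to_nat (c, v))))"
    by (intro sum_mono bound)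
  also have "\<dots> = (\<Sum>x\<in>pverts ?G. g x * (\<Sum>y\<in>{y \<in> pverts ?G. adjacent ?G x y}. g y))"
    unfolding sum_pverts by (intro sum.cong refl) (simp only: sum_neighbours_copies lessThan_iff)
  finally show "\<theta> * (\<Sum>x\<in>pverts ?G. (g x)\<^sup>2)
      \<le> (\<Sum>x\<in>pverts ?G. g x * (\<Sum>y\<in>{y \<in> pverts ?G. adjacent ?G x y}. g y))" .
qed

lemma pair_graph_copies:
  assumes "finite V" "symp_on V E" "irreflp_on V E"
  shows "pair_graph (copies n V E)"
proof
  let ?G = "copies n V E"
  show "finite (pverts ?G)" using assms by simp
  have "parcs ?G \<subseteq> pverts ?G \<times> pverts ?G"
    by (auto simp: copies_def)
  then show "finite (parcs ?G)"
    by (rule finite_subset) (simp add: assms(1))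
  show "symmetric (with_proj ?G)"
    using assms(2) by (auto simp: symmetric_def sym_def copies_def symp_on_def)
qed (use assms(3) in \<open>auto simp: copies_def irreflp_on_def\<close>)

lemma digraph_iso_card_verts:
  assumes "digraph_iso G H"
  shows "card (verts G) = card (verts H)"
  using assms
  by (auto simp: digraph_iso_def verts_app_iso card_image pre_digraph.digraph_isomorphism_def)

text \<open>Different numbers of copies have different numbers of vertices, which an isomorphism
  would preserve.\<close>

lemma infinitely_many_graphs_copies:
  assumes "finite V" "V \<noteq> {}" "symp_on V E" "irreflp_on V E"
    and "\<And>n. n > 0 \<Longrightarrow> P (copies n V E)"
  shows "infinitely_many_graphs P"
proof -
  \<comment> \<open>The shift by \<open>Suc\<close> leaves out the empty graph made of zero
    copies.\<close>
  let ?G = "\<lambda>n. copies (Suc n) V E"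
  have card: "card (pverts (?G n)) = Suc n * card V" for n
    by (simp add: card_image card_cartesian_product)
  have "card V > 0" using assms by (simp add: card_gt_0_iff)
  have noniso: "m = n" if "digraph_iso (with_proj (?G m)) (with_proj (?G n))" for m n
    using digraph_iso_card_verts[OF that] \<open>card V > 0\<close>
    unfolding with_proj_simps card by (simp only: mult_cancel2) simp
  have "inj ?G"
  proof (rule injI)
    fix m n assume "?G m = ?G n"
    then have "Suc m * card V = Suc n * card V" by (metis card)
    with \<open>card V > 0\<close> show "m = n" by (simp only: mult_cancel2) simp
  qed
  then have "infinite (range ?G)" by (simp add: finite_image_iff)
  moreover have "\<forall>G\<in>range ?G. pair_graph G \<and> pverts G \<noteq> {} \<and> P G"
    using assms pair_graph_copies by auto
  moreover have "pairwise (\<lambda>G H. \<not> digraph_iso (with_proj G) (with_proj H)) (range ?G)"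
    using noniso by (auto simp: pairwise_def)
  ultimately show ?thesis unfolding infinitely_many_graphs_def by blast
qed

section \<open>The Wagner graph\<close>

text \<open>For \<open>i\<close> and \<open>j\<close> below 8, differences 1 and 7 form the 8-cycle,
  7 being the edge that closes it, and 4 gives the antipodal chords.\<close>

definition wagner_adj :: "nat \<Rightarrow> nat \<Rightarrow> bool" where
  "wagner_adj i j \<longleftrightarrow> \<bar>int i - int j\<bar> \<in> {1, 4, 7}"

lemma all_less_8: "(\<forall>i<8::nat. P i) \<longleftrightarrow> P 0 \<and> P 1 \<and> P 2 \<and> P 3 \<and> P 4 \<and> P 5 \<and> P 6 \<and> P 7"
  by (simp add: numeral_eq_Suc All_less_Suc conj_ac)

lemma sum_less_8:
  "(\<Sum>i<8::nat. f i) = f 0 + f 1 + f 2 + f 3 + f 4 + f 5 + f 6 + (f 7 :: 'a::comm_monoid_add)"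
  by (simp add: eval_nat_numeral)

lemma sum_wagner_neighbours:
  "(\<Sum>j\<in>{j \<in> {..<8}. wagner_adj i j}. f j) = (\<Sum>j<8. if wagner_adj i j then f j else 0)"
  by (rule sum.inter_filter) simp

lemma wagner_regular:
  assumes "i < 8"
  shows "card {j \<in> {..<8}. wagner_adj i j} = 3"
proof -
  have "\<forall>i<8. (\<Sum>j<8. if wagner_adj i j then 1 else 0) = (3::nat)"
    by (simp add: all_less_8 sum_less_8 wagner_adj_def)
  with assms show ?thesis
    unfolding card_eq_sum sum_wagner_neighbours by blast
qed

text \<open>The distances 1, 4, 7 are all 1 modulo 3. Two steps in the same direction cover a
  distance that is 2 modulo 3, two steps in opposite directions a multiple of 3, so neither is a
  distance of neighbours.\<close>

lemma wagner_triangle_free: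
  assumes "wagner_adj i j" "wagner_adj j l"
  shows "\<not> wagner_adj i l"
proof -
  have *: "x \<in> {1, 4, 7, -1, -4, -7}" if "\<bar>x\<bar> \<in> {1, 4, 7}" for x :: int
    using that by (auto simp: abs_if split: if_splits)
  have "int i - int l = (int i - int j) + (int j - int l)" by simp
  moreover have "\<bar>x + y\<bar> \<notin> {1, 4, 7}" if "\<bar>x\<bar> \<in> {1, 4, 7}" "\<bar>y\<bar> \<in> {1, 4, 7}" for x y :: int
    using that[THEN *] by auto
  ultimately show ?thesis
    using assms unfolding wagner_adj_def by metis
qed

lemma wagner_form_bound:
  fixes g :: "nat \<Rightarrow> real"
  shows "(- 1 - sqrt 2) * (\<Sum>i<8. (g i)\<^sup>2)
    \<le> (\<Sum>i<8. g i * (\<Sum>j\<in>{j \<in> {..<8}. wagner_adj i j}. g j))"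
    (is "?L \<le> ?R")
proof -
  define r where "r = sqrt 2"
  have r: "r * r = 2" "r \<ge> 0" by (simp_all add: r_def)
  obtain s0 s1 s2 s3 where s: "s0 = g 0 + g 4" "s1 = g 1 + g 5" "s2 = g 2 + g 6" "s3 = g 3 + g 7"
    by simp
  obtain d0 d1 d2 d3 where d: "d0 = g 0 - g 4" "d1 = g 1 - g 5" "d2 = g 2 - g 6" "d3 = g 3 - g 7"
    by simp
  \<comment> \<open>The antipodal map splits the form into one on \<open>s\<close> and one on \<open>d\<close>; each is a sum of squares.\<close>
  have "r * ((2 * d0 + r * (d1 - d3))\<^sup>2 + (2 * d2 + r * (d1 + d3))\<^sup>2)
      = 4 * r * (d0\<^sup>2 + d2\<^sup>2) + 4 * (r * r) * (d0 * (d1 - d3) + d2 * (d1 + d3))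
        + 2 * (r * r) * r * (d1\<^sup>2 + d3\<^sup>2)"
    by (simp add: power2_eq_square algebra_simps)
  also have "\<dots> = 4 * r * (d0\<^sup>2 + d1\<^sup>2 + d2\<^sup>2 + d3\<^sup>2)
      + 8 * (d0 * (d1 - d3) + d2 * (d1 + d3))"
    unfolding r(1) by (simp add: algebra_simps)
  \<comment> \<open>The chords act on \<open>d\<close> as -1. What remains is the form of a 4-cycle
    in which the edge between \<open>d3\<close> and \<open>d0\<close> carries a minus sign, since
    the antipodal map negates \<open>d\<close>; its least eigenvalue is
    \<open>- sqrt 2\<close>.\<close>
  finally have *: "0 \<le> 4 * r * (d0\<^sup>2 + d1\<^sup>2 + d2\<^sup>2 + d3\<^sup>2)
      + 8 * (d0 * (d1 - d3) + d2 * (d1 + d3))"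
    using r(2) by (metis mult_nonneg_nonneg add_nonneg_nonneg zero_le_power2)
  have "?R = 2 * (g 0 * g 1 + g 1 * g 2 + g 2 * g 3 + g 3 * g 4 + g 4 * g 5 + g 5 * g 6 + g 6 * g 7
      + g 7 * g 0 + g 0 * g 4 + g 1 * g 5 + g 2 * g 6 + g 3 * g 7)"
    unfolding sum_wagner_neighbours
    by (simp add: sum_less_8 wagner_adj_def distrib_left mult.commute)
  moreover have "?L = (- 1 - r) * ((g 0)\<^sup>2 + (g 1)\<^sup>2 + (g 2)\<^sup>2 + (g 3)\<^sup>2
      + (g 4)\<^sup>2 + (g 5)\<^sup>2 + (g 6)\<^sup>2 + (g 7)\<^sup>2)"
    by (simp only: sum_less_8 r_def)
  \<comment> \<open>On \<open>s\<close> the chords act as +1 and the 4-cycle gives at least -2, so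
    there is slack and equality forces \<open>s\<close> to vanish.\<close>
  ultimately have "8 * (?R - ?L) =
      4 * r * (s0\<^sup>2 + s1\<^sup>2 + s2\<^sup>2 + s3\<^sup>2)
      + 4 * ((s0 + s1)\<^sup>2 + (s1 + s2)\<^sup>2 + (s2 + s3)\<^sup>2 + (s3 + s0)\<^sup>2)
      + (4 * r * (d0\<^sup>2 + d1\<^sup>2 + d2\<^sup>2 + d3\<^sup>2) + 8 * (d0 * (d1 - d3) + d2 * (d1 + d3)))"
    unfolding s d by (simp add: power2_eq_square algebra_simps)
  also have "\<dots> \<ge> 0"
    by (rule add_nonneg_nonneg[OF _ *]) (simp add: r(2))
  finally show ?thesis by simp
qed

text \<open>This is the equality case of \<open>wagner_form_bound\<close>: antipodal values are
  opposite, so the sums \<open>s\<close> vanish, and so do both squares in the differences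
  \<open>d\<close>.\<close>

definition wagner_vec :: "nat \<Rightarrow> real" where
  "wagner_vec i = [-1, sqrt 2, -1, 0, 1, - sqrt 2, 1, 0] ! i"

lemma wagner_vec_eigen:
  assumes "i < 8"
  shows "(\<Sum>j\<in>{j \<in> {..<8}. wagner_adj i j}. wagner_vec j) = (- 1 - sqrt 2) * wagner_vec i"
proof -
  have "\<forall>i<8. (\<Sum>j<8. if wagner_adj i j then wagner_vec j else 0) = (- 1 - sqrt 2) * wagner_vec i"
    by (simp add: all_less_8 sum_less_8 wagner_adj_def wagner_vec_def algebra_simps)
  with assms show ?thesis
    unfolding sum_wagner_neighbours by blast
qed

lemma smallest_eigenvalue_wagner_copies:
  assumes "n > 0"
  shows "smallest_eigenvalue (copies n {..<8} wagner_adj) = - 1 - sqrt 2"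
  by (rule smallest_eigenvalue_copies[where f = wagner_vec and u = 0])
    (use assms wagner_vec_eigen wagner_form_bound in \<open>auto simp: wagner_vec_def\<close>)

section \<open>A regular graph from cliques and paths on three vertices\<close>

text \<open>
  The paths are (1, j, i), (0, j, i), (2, j, i), with middle vertex (0, j, i). The middle
  vertices with equal \<open>i\<close> form cliques of size \<open>m\<close>; the end vertices with equal first
  component and equal \<open>j\<close> form cliques of size \<open>m + 1\<close>.
\<close>

definition cp_verts :: "nat \<Rightarrow> (nat \<times> nat \<times> nat) set" where
  "cp_verts m = {..<3} \<times> {..<m} \<times> {..<Suc m}"

fun cp_adj :: "nat \<times> nat \<times> nat \<Rightarrow> nat \<times> nat \<times> nat \<Rightarrow> bool" where
  "cp_adj (a, j, i) (b, j', i') \<longleftrightarrow>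
     (if a \<noteq> b then (a = 0 \<or> b = 0) \<and> j = j' \<and> i = i'
      else if a = 0 then i = i' \<and> j \<noteq> j'
      else j = j' \<and> i \<noteq> i')"

lemma lessThan_3: "{..<3::nat} = {0, 1, 2}"
  by auto

lemma sum_cp_verts:
  "(\<Sum>u\<in>cp_verts m. h u) =
     (\<Sum>j<m. \<Sum>i<Suc m. h (0, j, i) + h (1, j, i) + (h (2, j, i) :: real))"
proof -
  have "(\<Sum>u\<in>cp_verts m. h u) = (\<Sum>a<3. \<Sum>j<m. \<Sum>i<Suc m. h (a, j, i))"
    unfolding cp_verts_def by (simp only: sum.cartesian_product case_prod_unfold fst_conv snd_conv
        prod.collapse)
  then show ?thesis
    unfolding lessThan_3 by (simp add: sum.distrib del: sum.lessThan_Suc)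
qed

text \<open>The clique contributes a full sum minus the term of the vertex itself; such full sums
  become squares in \<open>cp_form_bound\<close> and vanish in \<open>cp_vec_eigen\<close>.\<close>

lemma sum_cp_neighbours_middle:
  fixes f :: "_ \<Rightarrow> real"
  assumes "j < m" "i < Suc m"
  shows "(\<Sum>v\<in>{v \<in> cp_verts m. cp_adj (0, j, i) v}. f v)
       = (\<Sum>j'<m. f (0, j', i)) - f (0, j, i) + f (1, j, i) + f (2, j, i)"
proof -
  have "{v \<in> cp_verts m. cp_adj (0, j, i) v}
      = insert (1, j, i) (insert (2, j, i) ((\<lambda>j'. (0, j', i)) ` ({..<m} - {j})))"
    using assms unfolding cp_verts_def lessThan_3 by auto
  also have "sum f \<dots> = f (1, j, i) + f (2, j, i) + (\<Sum>j'\<in>{..<m} - {j}. f (0, j', i))"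
    by (subst sum.insert, simp, force, subst sum.insert, simp, force)
      (simp add: sum.reindex inj_on_def)
  finally show ?thesis
    using assms by (simp add: sum_diff1)
qed

lemma sum_cp_neighbours_end:
  fixes f :: "_ \<Rightarrow> real"
  assumes "j < m" "i < Suc m" "a \<in> {1, 2}"
  shows "(\<Sum>v\<in>{v \<in> cp_verts m. cp_adj (a, j, i) v}. f v)
       = (\<Sum>i'<Suc m. f (a, j, i')) - f (a, j, i) + f (0, j, i)"
proof -
  have "{v \<in> cp_verts m. cp_adj (a, j, i) v}
      = insert (0, j, i) ((\<lambda>i'. (a, j, i')) ` ({..<Suc m} - {i}))"
    using assms unfolding cp_verts_def lessThan_3 by auto
  also have "sum f \<dots> = f (0, j, i) + (\<Sum>i'\<in>{..<Suc m} - {i}. f (a, j, i'))"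
    using assms(3) by (subst sum.insert) (auto simp: sum.reindex inj_on_def)
  finally show ?thesis
    using assms by (simp add: sum_diff1 del: sum.lessThan_Suc)
qed

text \<open>The instance at \<open>Suc 0\<close> has the form to which simplification takes the
  label 1.\<close>

lemmas sum_cp_neighbours =
  sum_cp_neighbours_middle sum_cp_neighbours_end[of _ _ _ "Suc 0"] sum_cp_neighbours_end[of _ _ _ 2]

lemma cp_verts_cases:
  assumes "u \<in> cp_verts m"
  obtains j i where "j < m" "i < Suc m" "u = (0, j, i) \<or> u = (1, j, i) \<or> u = (2, j, i)"
  using assms unfolding cp_verts_def lessThan_3 by auto

text \<open>A middle vertex has \<open>m - 1\<close> neighbours in its clique and two on its path,
  an end vertex \<open>m\<close> and one. This is why the clique sizes differ by one.\<close>

lemma cp_regular: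
  assumes "u \<in> cp_verts m"
  shows "card {v \<in> cp_verts m. cp_adj u v} = Suc m"
proof -
  have "real (card {v \<in> cp_verts m. cp_adj u v}) = Suc m"
    using assms sum_cp_neighbours[where f = "\<lambda>_. 1"] by (elim cp_verts_cases disjE) simp_all
  then show ?thesis by simp
qed

text \<open>Completing squares in \<open>b\<close> and \<open>c\<close> leaves two squares, which
  vanish for \<open>a = sqrt 2\<close> and \<open>b = c = -1\<close>.\<close>

lemma path3_form_bound:
  fixes a b c :: real
  shows "- sqrt 2 * (a\<^sup>2 + b\<^sup>2 + c\<^sup>2) \<le> 2 * a * (b + c)"
proof -
  define r where "r = sqrt 2"
  have r: "r * r = 2" "r \<ge> 0" by (simp_all add: r_def)
  have "r * ((2 * b + r * a)\<^sup>2 + (2 * c + r * a)\<^sup>2)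
      = 4 * r * (b\<^sup>2 + c\<^sup>2) + 4 * (r * r) * a * (b + c) + 2 * (r * r) * r * a\<^sup>2"
    by (simp add: power2_eq_square algebra_simps)
  then have "4 * (2 * a * (b + c) + r * (a\<^sup>2 + b\<^sup>2 + c\<^sup>2)) = r * ((2 * b + r * a)\<^sup>2 + (2 * c + r * a)\<^sup>2)"
    unfolding r(1) by (simp add: algebra_simps)
  also have "\<dots> \<ge> 0" using r(2) by simp
  finally show ?thesis by (simp add: r_def)
qed

lemma cp_form_bound:
  fixes g :: "nat \<times> nat \<times> nat \<Rightarrow> real"
  shows "(- 1 - sqrt 2) * (\<Sum>u\<in>cp_verts m. (g u)\<^sup>2)
    \<le> (\<Sum>u\<in>cp_verts m. g u * (\<Sum>v\<in>{v \<in> cp_verts m. cp_adj u v}. g v))"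
proof -
  define a where "a j i = g (0, j, i)" for j i
  define b where "b j i = g (1, j, i)" for j i
  define c where "c j i = g (2, j, i)" for j i
  define q where "q j i = (a j i)\<^sup>2 + (b j i)\<^sup>2 + (c j i)\<^sup>2" for j i
  let ?I = "{..<Suc m}"
  \<comment> \<open>\<open>?C\<close> is the form of the cliques with a loop added at every vertex.
    Grouped by cliques it is a sum of squares of clique sums, hence nonnegative; removing the loops
    subtracts each \<open>q j i\<close> once.\<close>
  let ?C = "\<Sum>j<m. \<Sum>i\<in>?I. a j i * (\<Sum>j'<m. a j' i) + b j i * (\<Sum>i'\<in>?I. b j i')
    + c j i * (\<Sum>i'\<in>?I. c j i')"
  \<comment> \<open>A middle clique runs over \<open>j\<close> with \<open>i\<close> fixed, so the
    order of summation is exchanged first.\<close>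
  have "(\<Sum>j<m. \<Sum>i\<in>?I. a j i * (\<Sum>j'<m. a j' i)) = (\<Sum>i\<in>?I. (\<Sum>j<m. a j i)\<^sup>2)"
    by (subst sum.swap) (simp only: power2_eq_square sum_distrib_right)
  then have "?C = (\<Sum>i\<in>?I. (\<Sum>j<m. a j i)\<^sup>2) + (\<Sum>j<m. (\<Sum>i\<in>?I. b j i)\<^sup>2)
      + (\<Sum>j<m. (\<Sum>i\<in>?I. c j i)\<^sup>2)"
    by (simp only: sum.distrib power2_eq_square sum_distrib_right)
  then have "0 \<le> ?C" by (simp add: sum_nonneg del: sum.lessThan_Suc)
  moreover have "- sqrt 2 * (\<Sum>j<m. \<Sum>i\<in>?I. q j i) \<le> (\<Sum>j<m. \<Sum>i\<in>?I. 2 * a j i * (b j i + c j i))"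
    unfolding sum_distrib_left q_def by (intro sum_mono path3_form_bound)
  moreover have "(\<Sum>u\<in>cp_verts m. (g u)\<^sup>2) = (\<Sum>j<m. \<Sum>i\<in>?I. q j i)"
    by (simp only: sum_cp_verts a_def b_def c_def q_def)
  moreover have "(\<Sum>u\<in>cp_verts m. g u * (\<Sum>v\<in>{v \<in> cp_verts m. cp_adj u v}. g v))
      = (\<Sum>j<m. \<Sum>i\<in>?I. (a j i * (\<Sum>j'<m. a j' i) + b j i * (\<Sum>i'\<in>?I. b j i')
          + c j i * (\<Sum>i'\<in>?I. c j i')) + 2 * a j i * (b j i + c j i) - q j i)"
    unfolding sum_cp_verts
  proof (intro sum.cong refl, unfold lessThan_iff)
    fix j i assume "j < m" "i < Suc m"
    then show "g (0, j, i) * (\<Sum>v\<in>{v \<in> cp_verts m. cp_adj (0, j, i) v}. g v)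
        + g (1, j, i) * (\<Sum>v\<in>{v \<in> cp_verts m. cp_adj (1, j, i) v}. g v)
        + g (2, j, i) * (\<Sum>v\<in>{v \<in> cp_verts m. cp_adj (2, j, i) v}. g v)
      = a j i * (\<Sum>j'<m. a j' i) + b j i * (\<Sum>i'\<in>?I. b j i')
          + c j i * (\<Sum>i'\<in>?I. c j i') + 2 * a j i * (b j i + c j i) - q j i"
      by (simp add: sum_cp_neighbours a_def b_def c_def q_def algebra_simps power2_eq_square
          del: sum.lessThan_Suc)
  qed
  ultimately show ?thesis
    by (simp add: sum.distrib sum_subtractf algebra_simps del: sum.lessThan_Suc)
qed

text \<open>A nonzero function with sum zero, supported on 0 and 1 so that it serves both clique
  sizes \<open>m\<close> and \<open>m + 1\<close>.\<close>

definition balanced :: "nat \<Rightarrow> real" where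
  "balanced j = (if j = 0 then 1 else if j = 1 then -1 else 0)"

lemma sum_balanced:
  assumes "n \<ge> 2"
  shows "(\<Sum>j<n. balanced j) = 0"
  using assms by (induction n rule: dec_induct) (simp_all add: balanced_def eval_nat_numeral)

text \<open>On each path the values are a multiple of \<open>sqrt 2\<close> in the middle and -1 at
  the ends, an eigenvector of the path for \<open>- sqrt 2\<close>. The factors
  \<open>balanced\<close> make every clique sum zero, so the cliques contribute the eigenvalue
  -1.\<close>

fun cp_vec :: "nat \<times> nat \<times> nat \<Rightarrow> real" where
  "cp_vec (a, j, i) = (if a = 0 then sqrt 2 else -1) * balanced j * balanced i"

lemma cp_vec_eigen:
  assumes "m \<ge> 2" "u \<in> cp_verts m"
  shows "(\<Sum>v\<in>{v \<in> cp_verts m. cp_adj u v}. cp_vec v) = (- 1 - sqrt 2) * cp_vec u"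
  using assms(2)
proof (rule cp_verts_cases)
  fix j i assume "j < m" "i < Suc m" and u: "u = (0, j, i) \<or> u = (1, j, i) \<or> u = (2, j, i)"
  moreover have "(\<Sum>j'<m. sqrt 2 * balanced j' * balanced i) = 0"
    using sum_balanced[OF assms(1)]
    by (simp flip: sum_distrib_left sum_distrib_right)
  moreover have "(\<Sum>i'<Suc m. - (balanced j * balanced i')) = 0"
    using sum_balanced[of "Suc m"] assms(1)
    by (simp add: sum_negf del: sum.lessThan_Suc flip: sum_distrib_left)
  ultimately show ?thesis
    by (elim disjE) (simp_all add: sum_cp_neighbours algebra_simps del: sum.lessThan_Suc)
qed

lemma smallest_eigenvalue_cp_copies:
  assumes "n > 0" "m \<ge> 2"
  shows "smallest_eigenvalue (copies n (cp_verts m) cp_adj) = - 1 - sqrt 2"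
proof (rule smallest_eigenvalue_copies[where f = cp_vec and u = "(0, 0, 0)"])
  show "finite (cp_verts m)" by (simp add: cp_verts_def)
  show "(0, 0, 0) \<in> cp_verts m" using assms by (simp add: cp_verts_def)
  show "cp_vec (0, 0, 0) \<noteq> 0" by (simp add: balanced_def)
qed (use assms cp_vec_eigen cp_form_bound in auto)

theorem theorem1p4:
  fixes k :: nat
  assumes "k \<ge> 3"
  shows "infinitely_many_graphs
           (\<lambda>G. k_regular k G \<and> smallest_eigenvalue G \<in> {-1 - sqrt 2 ..< -2})
         \<and> infinitely_many_graphs
           (\<lambda>G. k_regular 3 G \<and> triangle_free G \<and> smallest_eigenvalue G \<in> {-1 - sqrt 2 ..< -2})"
proof
  \<comment> \<open>Every graph in both families attains the left end of the interval, which lies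
    below -2 as \<open>sqrt 2 > 1\<close>.\<close>
  have \<theta>: "-1 - sqrt 2 \<in> {-1 - sqrt 2 ..< (-2 :: real)}"
    using real_less_rsqrt[of 1 2] by simp
  \<comment> \<open>The graph on \<open>cp_verts m\<close> has degree \<open>Suc m\<close>, and
    \<open>k >= 3\<close> gives the \<open>m >= 2\<close> with which \<open>balanced\<close> sums to
    zero over cliques of size \<open>m\<close>.\<close>
  obtain m where k: "k = Suc m" and m: "m \<ge> 2"
    using assms by (cases k) auto
  show "infinitely_many_graphs
      (\<lambda>G. k_regular k G \<and> smallest_eigenvalue G \<in> {-1 - sqrt 2 ..< -2})"
  proof (rule infinitely_many_graphs_copies)
    show "finite (cp_verts m)" by (simp add: cp_verts_def)
    have "(0, 0, 0) \<in> cp_verts m" using m by (simp add: cp_verts_def)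
    then show "cp_verts m \<noteq> {}" by blast
    show "symp_on (cp_verts m) cp_adj" "irreflp_on (cp_verts m) cp_adj"
      by (auto simp: symp_on_def irreflp_on_def split: if_splits)
    fix n :: nat assume "n > 0"
    then show "k_regular k (copies n (cp_verts m) cp_adj)
        \<and> smallest_eigenvalue (copies n (cp_verts m) cp_adj) \<in> {-1 - sqrt 2 ..< -2}"
      unfolding smallest_eigenvalue_cp_copies[OF \<open>n > 0\<close> m] k
      using \<theta> by (blast intro: k_regular_copies cp_regular)
  qed
  show "infinitely_many_graphs
      (\<lambda>G. k_regular 3 G \<and> triangle_free G \<and> smallest_eigenvalue G \<in> {-1 - sqrt 2 ..< -2})"
  proof (rule infinitely_many_graphs_copies)
    show "finite {..<8::nat}" "{..<8::nat} \<noteq> {}"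
      by (simp_all add: lessThan_empty_iff)
    show "symp_on {..<8} wagner_adj" "irreflp_on {..<8} wagner_adj"
      by (auto simp: symp_on_def irreflp_on_def wagner_adj_def)
    fix n :: nat assume "n > 0"
    have "k_regular 3 (copies n {..<8} wagner_adj)"
      by (rule k_regular_copies) (simp add: wagner_regular[unfolded lessThan_iff])
    moreover have "triangle_free (copies n {..<8} wagner_adj)"
      by (rule triangle_free_copies) (use wagner_triangle_free in auto)
    ultimately show "k_regular 3 (copies n {..<8} wagner_adj)
        \<and> triangle_free (copies n {..<8} wagner_adj)
        \<and> smallest_eigenvalue (copies n {..<8} wagner_adj) \<in> {-1 - sqrt 2 ..< -2}"
      unfolding smallest_eigenvalue_wagner_copies[OF \<open>n > 0\<close>] using \<theta> by blast
  qed
qed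

end
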